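(* For every integer $n \ge 4$, the number of primes $p$ with $3n < p < 4n$ is at least $$\log_{4n}\left(\frac{\sqrt{3}\,\pi^{3/2}}{332800}\, e^{E}\, M^{n}\, (4n)^{-\sqrt{n}}\, n^{-5/2}\right),$$ where $E = E(n)$ and $M$ are the explicit quantities defined in the context.
   Context: Here $\pi$ denotes the circle constant $3.14159\ldots$, and $\log_{4n}$ denotes the logarithm to base $4n$. For a positive integer $n$, define the real number $$E = E(n) = \frac{1}{48n+1} - \frac{1}{36n} - \frac{1}{12n} - \frac{1}{16n} + \frac{1}{12n+1} + \frac{1}{4n+1} - \frac{1}{24n} + \frac{1}{18n+1} + \frac{1}{6n+1} - \frac{17}{48n} + \frac{13}{36n+13} + \frac{221}{12n+221} - \frac{7}{24n} + \frac{5}{16n+5} + \frac{35}{8n+35},$$ and define the real constant $$M = \frac{256}{27}\cdot\left(\frac{1}{4}\right)^{4/3}\cdot 3\cdot\frac{3^{3/2}}{16}\cdot\left(\frac{1}{221}\right)^{1/221}\cdot\left(\frac{3}{13}\right)^{3/13}\cdot\left(\frac{17}{4}\right)^{4/17}\cdot\left(\frac{2}{105}\right)^{2/105}\cdot\left(\frac{4}{15}\right)^{4/15}\cdot\left(\frac{7}{2}\right)^{2/7}\cdot 4^{-1/6}.$$ *)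

theory Defs
  imports Complex_Main "HOL-Computational_Algebra.Primes"
begin

definition E :: "nat \<Rightarrow> real" where
  "E n =
     1 / (48 * real n + 1) - 1 / (36 * real n) - 1 / (12 * real n) - 1 / (16 * real n)
     + 1 / (12 * real n + 1) + 1 / (4 * real n + 1) - 1 / (24 * real n)
     + 1 / (18 * real n + 1) + 1 / (6 * real n + 1) - 17 / (48 * real n)
     + 13 / (36 * real n + 13) + 221 / (12 * real n + 221) - 7 / (24 * real n)
     + 5 / (16 * real n + 5) + 35 / (8 * real n + 35)"

definition M :: real where
  "M = 256 / 27 * (1 / 4) powr (4 / 3) * 3 * (3 powr (3 / 2) / 16)
       * (1 / 221) powr (1 / 221) * (3 / 13) powr (3 / 13) * (17 / 4) powr (4 / 17)
       * (2 / 105) powr (2 / 105) * (4 / 15) powr (4 / 15) * (7 / 2) powr (2 / 7)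
       * 4 powr (- 1 / 6)"

end

theory Submission
  imports Defs "HOL-Number_Theory.Prime_Powers" "HOL-Analysis.Complex_Transcendental"
begin

text \<open>
  Write \<open>\<psi>(x)\<close> for the sum of the von Mangoldt function over \<open>d \<le> x\<close>.  The quantity \<open>M\<close> is
  barely larger than \<open>1\<close> (\<open>ln M\<close> is about \<open>0.0515\<close>), so taking logarithms, the claim follows from
  \<open>\<pi>(3n,4n) ln (4n) \<ge> n/10 - \<surd>n ln (4n)\<close>, where \<open>\<pi>(3n,4n)\<close> counts the primes in between: we have
  \<open>ln M \<le> 1/10\<close> (lemma \<open>ln_M_le\<close>) and the remaining factors \<open>\<surd>3 \<pi>\<^sup>3\<^sup>/\<^sup>2 / 332800\<close>, \<open>exp (E n)\<close>
  and \<open>n\<^sup>-\<^sup>5\<^sup>/\<^sup>2\<close> have product at most \<open>1\<close> (lemma \<open>factor_le_1\<close>).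

  For \<open>n < 2500\<close> the right-hand side of this inequality is not positive.  For larger \<open>n\<close> two facts
  are combined.  First, the term \<open>\<surd>n ln (4n)\<close> pays for proper prime powers: every prime
  \<open>p \<le> 2\<surd>n\<close> has at most one power in \<open>(3n,4n]\<close>, and contributes at most
  \<open>ln (2\<surd>n)\<close>; hence \<open>\<pi>(3n,4n) ln (4n) + \<surd>n ln (4n) \<ge> \<psi>(4n) - \<psi>(3n)\<close>
  (lemma \<open>psi_diff_le_card_primes\<close>).  Second, Chebyshev's method gives
  \<open>A x - O(ln x) \<le> \<psi>(x) \<le> (6/5)(A + \<epsilon>) x + O(ln x)\<close> with \<open>A \<approx> 0.9213\<close>
  (lemmas \<open>psi_lower\<close> and \<open>psi_upper\<close>), so that \<open>\<psi>(4n) - \<psi>(3n)\<close> is roughly at least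
  \<open>(4 - 18/5) A n \<approx> 0.37 n\<close>, which beats \<open>n/10\<close> comfortably.

  Chebyshev's bounds come from \<open>ln n! = \<Sum>\<^sub>d \<Lambda>(d) \<lfloor>n/d\<rfloor>\<close>: in
  \<open>ln n! - ln \<lfloor>n/2\<rfloor>! - ln \<lfloor>n/3\<rfloor>! - ln \<lfloor>n/5\<rfloor>! + ln \<lfloor>n/30\<rfloor>!\<close>
  every \<open>\<Lambda>(d)\<close> receives the coefficient \<open>0\<close> or \<open>1\<close>, and the coefficient \<open>1\<close> if \<open>n/6 < d \<le> n\<close>,
  so this combination lies between \<open>\<psi>(n) - \<psi>(n/6)\<close> and \<open>\<psi>(n)\<close>; Stirling's formula evaluates it.
\<close>

section \<open>Factorials and the von Mangoldt function\<close>

definition chebyshev_psi :: "nat \<Rightarrow> real" where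
  "chebyshev_psi n = (\<Sum>d=1..n. mangoldt d)"

definition ln_fact :: "nat \<Rightarrow> real" where
  "ln_fact n = ln (fact n)"

lemma ln_fact_Suc: "ln_fact (Suc n) = ln (real (Suc n)) + ln_fact n"
  unfolding ln_fact_def by (simp add: ln_mult del: of_nat_Suc)

text \<open>
  Passing from \<open>m\<close> to \<open>m + 1\<close> increases \<open>m div d\<close> exactly for the divisors \<open>d\<close> of \<open>m + 1\<close>, and
  their von Mangoldt values add up to \<open>ln (m + 1)\<close>.  The range of summation may exceed \<open>m\<close>, so
  that factorials of several numbers can be compared term by term.
\<close>

lemma ln_fact_eq_sum_mangoldt:
  "m \<le> N \<Longrightarrow> ln_fact m = (\<Sum>d=1..N. mangoldt d * real (m div d))"
proof (induction m)
  case 0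
  show ?case by (simp add: ln_fact_def)
next
  case (Suc m)
  have "(\<Sum>d=1..N. mangoldt d * real (Suc m div d))
      = (\<Sum>d=1..N. mangoldt d * real (m div d) + (if d dvd Suc m then mangoldt d else 0))"
    by (intro sum.cong refl) (auto simp: div_Suc mod_eq_0_iff_dvd algebra_simps)
  also have "\<dots> = ln_fact m + (\<Sum>d=1..N. if d dvd Suc m then mangoldt d else 0)"
    using Suc by (simp add: sum.distrib)
  also have "(\<Sum>d=1..N. if d dvd Suc m then mangoldt d else 0)
      = (\<Sum>d | d dvd Suc m. mangoldt d :: real)"
  proof -
    have "{d \<in> {1..N}. d dvd Suc m} = {d. d dvd Suc m}"
      using Suc.prems by (auto dest: dvd_imp_le intro!: Suc_leI intro: Nat.gr0I)
    thus ?thesis by (subst sum.inter_filter [symmetric]) auto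
  qed
  also have "\<dots> = ln (real (Suc m))"
    by (subst mangoldt_sum) auto
  finally show ?case by (simp add: ln_fact_Suc del: of_nat_Suc)
qed

definition chebyshev_comb :: "nat \<Rightarrow> real" where
  "chebyshev_comb n =
     ln_fact n - ln_fact (n div 2) - ln_fact (n div 3) - ln_fact (n div 5) + ln_fact (n div 30)"

text \<open>
  The following integer is the coefficient of \<open>\<Lambda>(d)\<close> in \<open>chebyshev_comb n\<close> for \<open>k = n div d\<close>.
  Since \<open>1 - 1/2 - 1/3 - 1/5 + 1/30 = 0\<close>, it is periodic in \<open>k\<close> with period \<open>30\<close>.
\<close>

definition chebyshev_coeff :: "nat \<Rightarrow> int" where
  "chebyshev_coeff k = int k - int (k div 2) - int (k div 3) - int (k div 5) + int (k div 30)"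

lemma chebyshev_coeff_bounds: "chebyshev_coeff k \<in> {0, 1}"
proof -
  define q r where "q = k div 30" and "r = k mod 30"
  have k: "k = 30 * q + r" and r: "r < 30" by (simp_all add: q_def r_def)
  have d: "k div 2 = 15 * q + r div 2" "k div 3 = 10 * q + r div 3"
          "k div 5 = 6 * q + r div 5" "k div 30 = q"
    using r unfolding k by linarith+
  have "chebyshev_coeff k = int r - int (r div 2) - int (r div 3) - int (r div 5)"
    unfolding chebyshev_coeff_def d unfolding k by simp
  moreover have "\<forall>r\<in>{..<30::nat}. int r - int (r div 2) - int (r div 3) - int (r div 5) \<in> {0, 1}"
    by (simp add: lessThan_nat_numeral lessThan_Suc)
  ultimately show ?thesis using r by simp
qed

lemma chebyshev_coeff_eq_1:
  assumes "1 \<le> k" "k < 6"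
  shows   "chebyshev_coeff k = 1"
proof -
  have "k \<in> {1, 2, 3, 4, 5}" using assms by auto
  thus ?thesis by (auto simp: chebyshev_coeff_def)
qed

lemma chebyshev_comb_eq_sum:
  "chebyshev_comb n = (\<Sum>d=1..n. mangoldt d * real_of_int (chebyshev_coeff (n div d)))"
proof -
  have *: "ln_fact (n div k) = (\<Sum>d=1..n. mangoldt d * real (n div d div k))" for k
    by (subst ln_fact_eq_sum_mangoldt [of _ n]) (auto simp: div_mult2_eq [symmetric] mult.commute)
  have "ln_fact n = (\<Sum>d=1..n. mangoldt d * real (n div d))"
    by (rule ln_fact_eq_sum_mangoldt) simp
  thus ?thesis
    unfolding chebyshev_comb_def * chebyshev_coeff_def
    by (simp add: sum.distrib sum_subtractf algebra_simps)
qed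

lemma chebyshev_comb_le_psi: "chebyshev_comb n \<le> chebyshev_psi n"
  unfolding chebyshev_comb_eq_sum chebyshev_psi_def
proof (intro sum_mono)
  fix d
  show "mangoldt d * real_of_int (chebyshev_coeff (n div d)) \<le> mangoldt d"
    using chebyshev_coeff_bounds[of "n div d"] by (auto simp: mangoldt_nonneg)
qed

lemma psi_le_chebyshev_comb: "chebyshev_psi n \<le> chebyshev_comb n + chebyshev_psi (n div 6)"
proof -
  have "chebyshev_psi (n div 6) = (\<Sum>d | d \<in> {1..n} \<and> d \<le> n div 6. mangoldt d)"
    unfolding chebyshev_psi_def by (intro sum.cong) auto
  also have "\<dots> = (\<Sum>d=1..n. if d \<le> n div 6 then mangoldt d else 0)"
    by (subst sum.inter_filter) auto
  finally have *: "chebyshev_comb n + chebyshev_psi (n div 6) =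
      (\<Sum>d=1..n. mangoldt d * real_of_int (chebyshev_coeff (n div d))
         + (if d \<le> n div 6 then mangoldt d else 0))"
    by (simp add: chebyshev_comb_eq_sum sum.distrib)
  show ?thesis unfolding * unfolding chebyshev_psi_def
  proof (intro sum_mono)
    fix d assume d: "d \<in> {1..n}"
    have "chebyshev_coeff (n div d) = 1" if "\<not> d \<le> n div 6"
    proof (rule chebyshev_coeff_eq_1)
      show "1 \<le> n div d" using d by (simp add: div_greater_zero_iff Suc_le_eq)
      have "n < 6 * d" using that by linarith
      thus "n div d < 6" using d by (simp add: div_less_iff_less_mult)
    qed
    thus "mangoldt d \<le> mangoldt d * real_of_int (chebyshev_coeff (n div d))
            + (if d \<le> n div 6 then mangoldt d else 0)"
      using chebyshev_coeff_bounds[of "n div d"] by (auto simp: mangoldt_nonneg)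
  qed
qed

section \<open>Stirling bounds\<close>

lemma ln_fact_lower: "n \<ge> 1 \<Longrightarrow> ln_fact n \<ge> real n * ln (real n) - real n"
proof (induction n rule: nat_induct_at_least)
  case base
  show ?case by (simp add: ln_fact_def)
next
  case (Suc n)
  have "ln (real (Suc n) / real n) \<le> real (Suc n) / real n - 1"
    using Suc by (intro ln_le_minus_one) auto
  hence "real n * ln (real (Suc n) / real n) \<le> 1"
    using Suc by (simp add: field_simps)
  hence "real n * ln (real (Suc n)) - real n * ln (real n) \<le> 1"
    using Suc by (subst (asm) ln_div) (auto simp: algebra_simps)
  thus ?case using Suc by (simp add: ln_fact_Suc algebra_simps)
qed

lemma ln_fact_upper: "n \<ge> 1 \<Longrightarrow> ln_fact n \<le> real n * ln (real n) - real n + ln (real n) + 1"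
proof (induction n rule: nat_induct_at_least)
  case base
  show ?case by (simp add: ln_fact_def)
next
  case (Suc n)
  have "ln (real n / real (Suc n)) \<le> real n / real (Suc n) - 1"
    using Suc by (intro ln_le_minus_one) auto
  hence "real (Suc n) * ln (real n / real (Suc n)) \<le> - 1"
    using Suc by (simp add: field_simps)
  hence "real (Suc n) * ln (real n) - real (Suc n) * ln (real (Suc n)) \<le> - 1"
    using Suc by (subst (asm) ln_div) (auto simp: algebra_simps)
  thus ?case using Suc by (simp add: ln_fact_Suc algebra_simps)
qed

text \<open>Convexity of \<open>x ln x - x\<close>, whose derivative is \<open>ln x\<close>.\<close>

lemma x_ln_x_convex:
  fixes y z :: real
  assumes "y > 0" "z > 0"
  shows   "(y * ln y - y) - (z * ln z - z) \<le> (y - z) * ln y"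
proof -
  have "ln (y / z) \<le> y / z - 1" using assms by (intro ln_le_minus_one) auto
  hence "z * ln (y / z) \<le> y - z" using assms by (simp add: field_simps)
  thus ?thesis using assms by (simp add: ln_div algebra_simps)
qed

text \<open>
  The error terms are expressed by \<open>ln n\<close> instead of \<open>ln (n / k)\<close> so that the bounds remain true
  for \<open>n < k\<close>, where the factorial is \<open>1\<close> and \<open>x ln x - x\<close> lies in \<open>[-1, 0]\<close>.
\<close>

lemma ln_fact_div_bounds:
  assumes n: "n \<ge> 1" and k: "k \<ge> 1"
  defines "x \<equiv> real n / real k"
  shows   "ln_fact (n div k) \<le> x * ln x - x + ln (real n) + 1"
    and   "ln_fact (n div k) \<ge> x * ln x - x - ln (real n)"
proof -
  have x: "x > 0" "x \<le> real n" using n k by (auto simp: x_def field_simps)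
  have ln_x: "ln x \<le> ln (real n)" using x by simp
  define m where "m = n div k"
  have m: "real m \<le> x" "x < real m + 1"
  proof -
    show "real m \<le> x" unfolding m_def x_def by (rule of_nat_div_le_of_nat)
    have "n < (m + 1) * k" unfolding m_def using k dividend_less_div_times[of k n] by simp
    hence "real n < real ((m + 1) * k)" by (rule of_nat_less_iff [THEN iffD2])
    thus "x < real m + 1" using k by (simp add: x_def pos_divide_less_eq algebra_simps)
  qed
  have ln_n: "ln (real n) \<ge> 0" using n by simp
  show "ln_fact (n div k) \<le> x * ln x - x + ln (real n) + 1"
  proof (cases "m = 0")
    case True
    have "x * ln x - x \<ge> -1"
      using x_ln_x_convex[of 1 x] x by simp
    thus ?thesis using True ln_n by (simp add: m_def [symmetric] ln_fact_def)
  next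
    case False
    have "(real m * ln (real m) - real m) - (x * ln x - x) \<le> (real m - x) * ln (real m)"
      using False x by (intro x_ln_x_convex) auto
    also have "\<dots> \<le> 0"
      using False m by (intro mult_nonpos_nonneg) auto
    finally have "real m * ln (real m) - real m \<le> x * ln x - x" by simp
    moreover have "ln (real m) \<le> ln (real n)" using False m x by simp
    moreover have "ln_fact m \<le> real m * ln (real m) - real m + ln (real m) + 1"
      using False by (intro ln_fact_upper) auto
    ultimately show ?thesis unfolding m_def [symmetric] by linarith
  qed
  show "ln_fact (n div k) \<ge> x * ln x - x - ln (real n)"
  proof (cases "m = 0")
    case True
    hence "ln x \<le> 0" using m x by simp
    hence "x * ln x \<le> 0" using x by (simp add: mult_nonneg_nonpos)
    hence "x * ln x - x - ln (real n) \<le> 0" using ln_n x by linarith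
    thus ?thesis using True by (simp add: m_def [symmetric] ln_fact_def)
  next
    case False
    have "(x * ln x - x) - (real m * ln (real m) - real m) \<le> (x - real m) * ln x"
      using False x by (intro x_ln_x_convex) auto
    also have "\<dots> \<le> 1 * ln x"
      using False m by (intro mult_right_mono) auto
    also have "\<dots> \<le> ln (real n)" using ln_x by simp
    finally have "real m * ln (real m) - real m \<ge> x * ln x - x - ln (real n)" by simp
    moreover have "ln_fact m \<ge> real m * ln (real m) - real m"
      using False by (intro ln_fact_lower) auto
    ultimately show ?thesis unfolding m_def [symmetric] by linarith
  qed
qed

section \<open>Chebyshev's bounds\<close>

text \<open>This is \<open>ln (2\<^sup>1\<^sup>/\<^sup>2 3\<^sup>1\<^sup>/\<^sup>3 5\<^sup>1\<^sup>/\<^sup>5 / 30\<^sup>1\<^sup>/\<^sup>3\<^sup>0)\<close>.\<close>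

definition chebyshev_const :: real where
  "chebyshev_const = (14 * ln 2 + 9 * ln 3 + 5 * ln 5) / 30"

text \<open>
  Writing \<open>ln (n / k) = ln n - ln k\<close> in the five main terms \<open>(n/k) ln (n/k) - n/k\<close>, the multiples of
  \<open>n ln n\<close> and \<open>n\<close> cancel because \<open>1 - 1/2 - 1/3 - 1/5 + 1/30 = 0\<close>; what remains is
  \<open>n (ln 2 / 2 + ln 3 / 3 + ln 5 / 5 - ln 30 / 30)\<close>.
\<close>

lemma chebyshev_comb_bounds:
  assumes n: "n \<ge> 1"
  shows "chebyshev_comb n \<ge> chebyshev_const * real n - 4 * ln (real n) - 3"
    and "chebyshev_comb n \<le> chebyshev_const * real n + 5 * ln (real n) + 2"
proof -
  have ln30: "ln (30::real) = ln 2 + ln 3 + ln 5"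
    using ln_mult[of 6 "5::real"] ln_mult[of 2 "3::real"] by simp
  have ln_div': "ln (real n / k) = ln (real n) - ln k" if "k > 0" for k :: real
    using n that by (simp add: ln_div)
  define L where "L = ln (real n)"
  have main: "(real n * L - real n)
      - (real n / 2 * ln (real n / 2) - real n / 2) - (real n / 3 * ln (real n / 3) - real n / 3)
      - (real n / 5 * ln (real n / 5) - real n / 5) + (real n / 30 * ln (real n / 30) - real n / 30)
      = chebyshev_const * real n"
    by (simp add: ln_div' ln30 L_def [symmetric] chebyshev_const_def field_simps)
  note bounds = ln_fact_div_bounds[OF n, of 2] ln_fact_div_bounds[OF n, of 3]
    ln_fact_div_bounds[OF n, of 5] ln_fact_div_bounds[OF n, of 30]
    ln_fact_lower[OF n] ln_fact_upper[OF n]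
  show "chebyshev_comb n \<ge> chebyshev_const * real n - 4 * ln (real n) - 3"
    using bounds main unfolding chebyshev_comb_def L_def by simp
  show "chebyshev_comb n \<le> chebyshev_const * real n + 5 * ln (real n) + 2"
    using bounds main unfolding chebyshev_comb_def L_def by simp
qed

lemma psi_lower:
  "n \<ge> 1 \<Longrightarrow> chebyshev_psi n \<ge> chebyshev_const * real n - 4 * ln (real n) - 3"
  using chebyshev_comb_bounds(1)[of n] chebyshev_comb_le_psi[of n] by linarith

lemma ln_le_tangent:
  fixes x t :: real
  assumes "x > 0" "t > 0"
  shows   "ln x \<le> x / t + ln t - 1"
  using ln_le_minus_one[of "x / t"] assms by (simp add: ln_div)

text \<open>
  Since \<open>2.7 \<le> e \<le> 2.72\<close>, comparing powers of rationals bounds a logarithm by a rational, with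
  ample precision for all numerical comparisons below.
\<close>

lemma ln_le_rational:
  assumes "x > 0" "q > 0" "x ^ q \<le> (27/10) ^ p"
  shows   "ln x \<le> real p / real q"
proof -
  have "(27/10 :: real) \<le> exp 1" using e_approx_32 by (simp add: abs_if split: if_splits)
  hence "(27/10 :: real) ^ p \<le> exp 1 ^ p" by (intro power_mono) auto
  with assms have "x ^ q \<le> exp (real p)" by (simp add: exp_of_nat_mult [symmetric])
  hence "ln (x ^ q) \<le> real p" using assms by (metis exp_le_cancel_iff exp_ln zero_less_power)
  thus ?thesis using assms by (simp add: ln_realpow field_simps)
qed

lemma ln_ge_rational:
  assumes "x > 0" "q > 0" "(68/25) ^ p \<le> x ^ q"
  shows   "ln x \<ge> real p / real q"
proof -
  have "exp 1 ^ p \<le> (68/25 :: real) ^ p" using e_less_272 by (intro power_mono) auto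
  with assms have "exp (real p) \<le> x ^ q" by (simp add: exp_of_nat_mult [symmetric])
  hence "real p \<le> ln (x ^ q)" using assms by (simp add: ln_ge_iff)
  thus ?thesis using assms by (simp add: ln_realpow field_simps)
qed

text \<open>
  The logarithmic error is absorbed into \<open>n/50\<close>; iterating \<open>\<psi>(n) \<le> C n + K + \<psi>(n/6)\<close> then
  multiplies \<open>C\<close> by \<open>1 + 1/6 + 1/36 + \<dots> = 6/5\<close> and collects \<open>K\<close> at most \<open>1 + ln n\<close> times, as
  \<open>ln 6 \<ge> 1\<close>.
\<close>

lemma psi_upper:
  "n \<ge> 1 \<Longrightarrow> chebyshev_psi n \<le> 6/5 * (chebyshev_const + 1/50) * real n + 27 * (1 + ln (real n))"
proof (induction n rule: less_induct)
  case (less n)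
  define B where "B = 6/5 * (chebyshev_const + 1/50)"
  have B: "B \<ge> 0" unfolding B_def chebyshev_const_def by simp
  have "ln (250::real) \<le> 6" using ln_le_rational[of 250 1 6] by (simp add: power_divide)
  moreover have "ln (real n) \<le> real n / 250 + ln 250 - 1"
    using less.prems by (intro ln_le_tangent) auto
  ultimately have "5 * ln (real n) \<le> real n / 50 + 25" by simp
  hence comb: "chebyshev_comb n \<le> 5/6 * B * real n + 27"
    using chebyshev_comb_bounds(2)[OF less.prems] by (simp add: B_def algebra_simps)
  have ln_n: "ln (real n) \<ge> 0" using less.prems by simp
  show ?case unfolding B_def [symmetric]
  proof (cases "n < 6")
    case True
    hence "chebyshev_psi (n div 6) = 0" by (simp add: chebyshev_psi_def)
    thus "chebyshev_psi n \<le> B * real n + 27 * (1 + ln (real n))"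
      using comb psi_le_chebyshev_comb[of n] ln_n mult_nonneg_nonneg[OF B of_nat_0_le_iff[of n]]
      by argo
  next
    case False
    define m where "m = n div 6"
    have m: "m \<ge> 1" "m < n" "real m \<le> real n / 6"
      using False of_nat_div_le_of_nat[of n 6, where ?'a = real] by (auto simp: m_def)
    have "ln (real m) \<le> ln (real n / 6)" using m by simp
    also have "\<dots> = ln (real n) - ln 6" using False by (simp add: ln_div)
    also have "\<dots> \<le> ln (real n) - 1" using ln_ge_rational[of 6 1 1] by simp
    finally have ln_m: "ln (real m) \<le> ln (real n) - 1" by simp
    have "B * real m \<le> B * (real n / 6)" using m B by (intro mult_left_mono) auto
    moreover have "chebyshev_psi m \<le> B * real m + 27 * (1 + ln (real m))"
      using less.IH[of m] m by (simp add: B_def)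
    ultimately show "chebyshev_psi n \<le> B * real n + 27 * (1 + ln (real n))"
      using comb psi_le_chebyshev_comb[of n] ln_m unfolding m_def [symmetric] by simp
  qed
qed

lemma chebyshev_const_ge: "chebyshev_const \<ge> 9/10"
proof -
  have "ln (2 ^ 14 * 3 ^ 9 * 5 ^ 5 :: real) \<ge> 27"
    using ln_ge_rational[of "2 ^ 14 * 3 ^ 9 * 5 ^ 5" 1 27] by (simp add: power_divide)
  also have "ln (2 ^ 14 * 3 ^ 9 * 5 ^ 5 :: real) = 14 * ln 2 + 9 * ln 3 + 5 * ln 5"
    by (simp add: ln_mult ln_realpow del: power_numeral)
  finally show ?thesis by (simp add: chebyshev_const_def)
qed

section \<open>From prime powers to primes\<close>

text \<open>
  This bounds the contribution of proper prime powers to \<open>\<psi>(4n) - \<psi>(3n)\<close>.  Two powers of the same prime differ at least by a factor \<open>2\<close>.  Hence a proper prime power in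
  \<open>(3n, 4n]\<close> is determined by its prime, which is at most \<open>\<surd>(4n)\<close>.
\<close>

lemma sum_mangoldt_prime_powers_le:
  assumes n: "n \<ge> 1"
  shows "(\<Sum>d | d \<in> {3*n<..4*n} \<and> \<not> prime d. mangoldt d) \<le> sqrt (real n) * ln (4 * real n)"
proof -
  define Q where "Q = {d \<in> {3*n<..4*n}. primepow d \<and> \<not> prime d}"
  define r where "r = nat \<lfloor>2 * sqrt (real n)\<rfloor>"
  have fin: "finite Q" by (simp add: Q_def)
  have sqrt4n: "(2 * sqrt (real n)) ^ 2 = 4 * real n" by (simp add: power_mult_distrib)
  have ln4n: "ln (4 * real n) \<ge> 0" using n by simp
  have base: "\<exists>k\<ge>2. prime (aprimedivisor d) \<and> d = aprimedivisor d ^ k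
                \<and> real (aprimedivisor d) \<le> 2 * sqrt (real n)" if d: "d \<in> Q" for d
  proof -
    from d obtain p k where pk: "prime p" "k > 0" "d = p ^ k"
      unfolding Q_def primepow_def by auto
    have p: "aprimedivisor d = p" using pk by (simp add: aprimedivisor_prime_power)
    have "k \<noteq> 1" using d pk by (auto simp: Q_def)
    hence k: "k \<ge> 2" using pk by simp
    have "p ^ 2 \<le> p ^ k" using k pk by (intro power_increasing prime_ge_1_nat) auto
    also have "\<dots> \<le> 4 * n" using d pk by (auto simp: Q_def)
    finally have "real (p ^ 2) \<le> real (4 * n)" by (rule of_nat_mono)
    hence "real p ^ 2 \<le> (2 * sqrt (real n)) ^ 2" by (simp add: sqrt4n)
    hence "real p \<le> 2 * sqrt (real n)" by (rule power2_le_imp_le) simp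
    thus ?thesis using k pk p by auto
  qed
  have inj: "inj_on aprimedivisor Q"
  proof (rule inj_onI)
    have aux: False if "p ^ j \<in> Q" "p ^ k \<in> Q" "j < k" "p \<ge> 2" for p j k :: nat
    proof -
      have "2 * p ^ j \<le> p * p ^ j" using that by simp
      also have "\<dots> = p ^ Suc j" by simp
      also have "\<dots> \<le> p ^ k" using that by (intro power_increasing) auto
      finally show False using that n by (auto simp: Q_def)
    qed
    fix c d assume c: "c \<in> Q" and d: "d \<in> Q" and eq: "aprimedivisor c = aprimedivisor d"
    obtain j where j: "prime (aprimedivisor c)" "c = aprimedivisor c ^ j" using base[OF c] by auto
    obtain k where k: "d = aprimedivisor c ^ k" using base[OF d] eq by auto
    have "aprimedivisor c \<ge> 2" using j by (simp add: prime_ge_2_nat)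
    thus "c = d" using aux[of "aprimedivisor c" j k] aux[of "aprimedivisor c" k j] c d j k
      by (metis nat_neq_iff)
  qed
  have "aprimedivisor ` Q \<subseteq> {1..r}"
  proof
    fix p assume "p \<in> aprimedivisor ` Q"
    then obtain d where d: "d \<in> Q" "p = aprimedivisor d" by auto
    with base[of d] have "prime p" "real p \<le> 2 * sqrt (real n)" by auto
    thus "p \<in> {1..r}" unfolding r_def
      using prime_ge_1_nat[of p] by (simp add: le_nat_floor)
  qed
  hence "card Q \<le> r" using card_mono[of "{1..r}" "aprimedivisor ` Q"] card_image[OF inj] by simp
  hence card: "real (card Q) \<le> 2 * sqrt (real n)"
    unfolding r_def by (rule order_trans [OF of_nat_mono of_nat_floor]) simp
  have "(\<Sum>d | d \<in> {3*n<..4*n} \<and> \<not> prime d. mangoldt d) = (\<Sum>d\<in>Q. mangoldt d :: real)"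
    by (intro sum.mono_neutral_right) (auto simp: Q_def mangoldt_def)
  also have "\<dots> \<le> (\<Sum>d\<in>Q. ln (4 * real n) / 2)"
  proof (intro sum_mono)
    fix d assume d: "d \<in> Q"
    from base[OF d] have p: "prime (aprimedivisor d)" "real (aprimedivisor d) \<le> 2 * sqrt (real n)"
      by auto
    have "0 < real (aprimedivisor d)" using prime_gt_0_nat[OF p(1)] by simp
    hence "2 * ln (real (aprimedivisor d)) \<le> 2 * ln (2 * sqrt (real n))"
      using p(2) n by (subst mult_le_cancel_left_pos) (auto simp: ln_le_cancel_iff)
    also have "\<dots> = ln ((2 * sqrt (real n)) ^ 2)"
      using n by (subst ln_realpow) auto
    also have "\<dots> = ln (4 * real n)" by (simp only: sqrt4n)
    finally show "mangoldt d \<le> ln (4 * real n) / 2" using d by (simp add: mangoldt_def Q_def)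
  qed
  also have "\<dots> = real (card Q) * (ln (4 * real n) / 2)" by simp
  also have "\<dots> \<le> (2 * sqrt (real n)) * (ln (4 * real n) / 2)"
    using card ln4n by (intro mult_right_mono) auto
  finally show ?thesis by simp
qed

text \<open>The upper end \<open>4n\<close> of the range of \<open>\<psi>\<close> is composite, so the open interval loses no prime.\<close>

lemma psi_diff_le_card_primes:
  assumes n: "n \<ge> 1"
  shows "chebyshev_psi (4*n) - chebyshev_psi (3*n)
           \<le> real (card {p. prime p \<and> 3*n < p \<and> p < 4*n}) * ln (4 * real n)
              + sqrt (real n) * ln (4 * real n)"
proof -
  define P where "P = {p. prime p \<and> 3*n < p \<and> p < 4*n}"
  have "{1..4*n} = {1..3*n} \<union> {3*n<..4*n}" by auto
  hence "chebyshev_psi (4*n) = chebyshev_psi (3*n) + (\<Sum>d\<in>{3*n<..4*n}. mangoldt d)"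
    unfolding chebyshev_psi_def by (simp only:) (subst sum.union_disjoint, auto)
  also have "(\<Sum>d\<in>{3*n<..4*n}. mangoldt d :: real)
      = (\<Sum>d | d \<in> {3*n<..4*n} \<and> prime d. mangoldt d)
        + (\<Sum>d | d \<in> {3*n<..4*n} \<and> \<not> prime d. mangoldt d)"
    by (subst sum.union_disjoint [symmetric]) (auto intro!: sum.cong)
  also have "{d. d \<in> {3*n<..4*n} \<and> prime d} = P"
  proof -
    have "\<not> prime (4 * n)" using prime_product[of 2 "2 * n"] by auto
    thus ?thesis unfolding P_def by (auto simp: le_less)
  qed
  also have "(\<Sum>d\<in>P. mangoldt d) \<le> (\<Sum>d\<in>P. ln (4 * real n))"
  proof (intro sum_mono)
    fix p assume "p \<in> P"
    hence p: "prime p" "real p \<le> real (4 * n)" unfolding P_def by auto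
    hence "ln (real p) \<le> ln (real (4 * n))"
      using prime_gt_0_nat[of p] by (subst ln_le_cancel_iff) auto
    thus "mangoldt p \<le> ln (4 * real n)" using p by simp
  qed
  finally show ?thesis
    using sum_mangoldt_prime_powers_le[OF n] unfolding P_def by simp
qed

section \<open>The constants of the statement\<close>

lemma M_pos: "M > 0"
  by (simp add: M_def)

text \<open>
  Collecting the powers of each prime,
  \<open>M = 2\<^sup>2\<^sup>0\<^sup>3\<^sup>/\<^sup>2\<^sup>5\<^sup>5 7\<^sup>4\<^sup>/\<^sup>1\<^sup>5 17\<^sup>3\<^sup>/\<^sup>1\<^sup>3 / (3\<^sup>1\<^sup>0\<^sup>1\<^sup>/\<^sup>1\<^sup>8\<^sup>2 5\<^sup>2\<^sup>/\<^sup>7 13\<^sup>4\<^sup>/\<^sup>1\<^sup>7)\<close>.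
\<close>

lemma ln_M:
  "ln M = 203/255 * ln 2 - 101/182 * ln 3 - 2/7 * ln 5 + 4/15 * ln 7 - 4/17 * ln 13 + 3/13 * ln 17"
proof -
  have l: "ln (256::real) = 8 * ln 2" "ln (27::real) = 3 * ln 3" "ln (4::real) = 2 * ln 2"
          "ln (16::real) = 4 * ln 2" "ln (9::real) = 2 * ln 3"
    using ln_realpow[of "2::real" 8] ln_realpow[of "3::real" 3] ln_realpow[of "2::real" 2]
          ln_realpow[of "2::real" 4] ln_realpow[of "3::real" 2] by simp_all
  have m: "ln (221::real) = ln 13 + ln 17" "ln (15::real) = ln 3 + ln 5"
          "ln (105::real) = ln 3 + ln 5 + ln 7"
    using ln_mult[of 13 "17::real"] ln_mult[of 3 "5::real"] ln_mult[of 15 "7::real"] by simp_all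
  show ?thesis
    unfolding M_def by (simp add: ln_mult ln_div ln_powr l m field_simps)
qed

lemma ln_M_le: "ln M \<le> 1/10"
proof -
  have "ln (2::real) \<le> 7/10" using ln_le_rational[of 2 10 7] by (simp add: power_divide)
  moreover have "ln (3::real) \<ge> 13/12" using ln_ge_rational[of 3 12 13] by (simp add: power_divide)
  moreover have "ln (5::real) \<ge> 8/5" using ln_ge_rational[of 5 5 8] by (simp add: power_divide)
  moreover have "ln (7::real) \<le> 2" using ln_le_rational[of 7 1 2] by (simp add: power_divide)
  moreover have "ln (13::real) \<ge> 23/9" using ln_ge_rational[of 13 9 23] by (simp add: power_divide)
  moreover have "ln (17::real) \<le> 20/7" using ln_le_rational[of 17 7 20] by (simp add: power_divide)
  ultimately show ?thesis unfolding ln_M by linarith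
qed

text \<open>Each of the nine positive summands of \<open>E n\<close> is at most \<open>1\<close>.\<close>

lemma E_le: "E n \<le> 9"
proof -
  have *: "a / (b * real n + a) \<le> 1" if "a > 0" "b > 0" for a b :: real
    using that by (simp add: divide_le_eq_1 add_nonneg_pos)
  have "1 / (48 * real n + 1) \<le> 1" "1 / (12 * real n + 1) \<le> 1" "1 / (4 * real n + 1) \<le> 1"
    "1 / (18 * real n + 1) \<le> 1" "1 / (6 * real n + 1) \<le> 1" "13 / (36 * real n + 13) \<le> 1"
    "221 / (12 * real n + 221) \<le> 1" "5 / (16 * real n + 5) \<le> 1" "35 / (8 * real n + 35) \<le> 1"
    by (rule *; simp)+
  moreover have "1 / (36 * real n) \<ge> 0" "1 / (12 * real n) \<ge> 0" "1 / (16 * real n) \<ge> 0"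
    "1 / (24 * real n) \<ge> 0" "17 / (48 * real n) \<ge> 0" "7 / (24 * real n) \<ge> 0"
    by simp_all
  ultimately show ?thesis unfolding E_def by argo
qed

lemma factor_le_1:
  assumes "n \<ge> 1"
  shows "sqrt 3 * pi powr (3/2) / 332800 * exp (E n) * real n powr (-5/2) \<le> 1"
proof -
  have "sqrt 3 \<le> sqrt (2\<^sup>2)" by (subst real_sqrt_le_iff) simp
  hence s: "sqrt 3 \<le> 2" by simp
  have "pi powr (3/2) \<le> 4 powr (3/2)" using pi_less_4 by (intro powr_mono2) auto
  also have "(4::real) powr (3/2) = (2 powr 2) powr (3/2)" by simp
  also have "\<dots> = 8" by (subst powr_powr) simp
  finally have p: "pi powr (3/2) \<le> 8" .
  have "exp (E n) \<le> exp 9" using E_le by simp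
  also have "\<dots> = exp 1 ^ 9" by (simp add: exp_of_nat_mult [symmetric])
  also have "\<dots> \<le> 3 ^ 9" using exp_le by (intro power_mono) auto
  finally have e: "exp (E n) \<le> 3 ^ 9" .
  have "real n powr (-5/2) \<le> real n powr 0" using assms by (intro powr_mono) auto
  hence q: "real n powr (-5/2) \<le> 1" using assms by simp
  have "sqrt 3 * pi powr (3/2) / 332800 * exp (E n) * real n powr (-5/2)
      \<le> 2 * 8 / 332800 * 3 ^ 9 * 1"
    using s p e q by (intro mult_mono divide_right_mono) auto
  also have "\<dots> \<le> 1" by simp
  finally show ?thesis .
qed

section \<open>Counting primes between \<open>3n\<close> and \<open>4n\<close>\<close>

text \<open>
  The left-hand side is \<open>\<surd>n (\<surd>n / 10 - ln (4n))\<close>, and \<open>\<surd>n / 10\<close> is at most \<open>2.5 \<le> ln 16\<close> for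
  \<open>n \<le> 625\<close> and at most \<open>5 \<le> ln 2500\<close> otherwise.
\<close>

lemma small_case:
  assumes n: "n \<ge> 4" "n < 2500"
  shows "real n / 10 - sqrt (real n) * ln (4 * real n) \<le> 0"
proof -
  have le: "sqrt (real n) / 10 \<le> ln (4 * real n)"
  proof (cases "n \<le> 625")
    case True
    have "sqrt (real n) \<le> sqrt (25\<^sup>2)" using True by (subst real_sqrt_le_iff) simp
    hence "sqrt (real n) / 10 \<le> 5/2" by simp
    also have "5/2 \<le> ln (16::real)" using ln_ge_rational[of 16 2 5] by (simp add: power_divide)
    also have "\<dots> \<le> ln (4 * real n)" using n by simp
    finally show ?thesis .
  next
    case False
    have "sqrt (real n) \<le> sqrt (50\<^sup>2)" using n by (subst real_sqrt_le_iff) simp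
    hence "sqrt (real n) / 10 \<le> 5" by simp
    also have "5 \<le> ln (2500::real)" using ln_ge_rational[of 2500 1 5] by (simp add: power_divide)
    also have "\<dots> \<le> ln (4 * real n)" using False by simp
    finally show ?thesis .
  qed
  have "real n / 10 = sqrt (real n) * (sqrt (real n) / 10)" by simp
  also have "\<dots> \<le> sqrt (real n) * ln (4 * real n)" using le by (intro mult_left_mono) auto
  finally show ?thesis by simp
qed

text \<open>
  The linear terms leave at least \<open>(2/5) A n - 9n/125 \<ge> 0.288 n\<close>, from which \<open>n/10\<close> and the error
  \<open>31 ln n + O(1)\<close> are to be paid; the tangent to the logarithm at \<open>2500\<close> makes this a linear
  inequality in \<open>n\<close>.
\<close>

lemma psi_diff_large:
  assumes n: "n \<ge> 2500"
  shows "real n / 10 \<le> chebyshev_psi (4*n) - chebyshev_psi (3*n)"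
proof -
  have ln4: "ln (4::real) \<le> 3/2" using ln_le_rational[of 4 2 3] by (simp add: power_divide)
  have ln3: "ln (3::real) \<le> 3/2" using ln_le_rational[of 3 2 3] by (simp add: power_divide)
  have ln2500: "ln (2500::real) \<le> 8" using ln_le_rational[of 2500 1 8] by (simp add: power_divide)
  have "ln (real n) \<le> real n / 2500 + ln 2500 - 1" using n by (intro ln_le_tangent) auto
  hence ln_n: "ln (real n) \<le> real n / 2500 + 7" using ln2500 by simp
  have low: "chebyshev_psi (4*n) \<ge> chebyshev_const * (4 * real n) - 4 * (ln 4 + ln (real n)) - 3"
    using psi_lower[of "4*n"] n by (simp add: ln_mult)
  have upp: "chebyshev_psi (3*n)
      \<le> 6/5 * (chebyshev_const + 1/50) * (3 * real n) + 27 * (1 + (ln 3 + ln (real n)))"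
    using psi_upper[of "3*n"] n by (simp add: ln_mult)
  have "9/10 * real n \<le> chebyshev_const * real n"
    using chebyshev_const_ge by (intro mult_right_mono) auto
  moreover have "real n \<ge> 2500" using n by simp
  ultimately show ?thesis using low upp ln_n ln3 ln4 by argo
qed

theorem theorem2p3:
  fixes n :: nat
  assumes "n \<ge> 4"
  shows "real (card {p :: nat. prime p \<and> 3 * n < p \<and> p < 4 * n})
           \<ge> log (4 * real n)
                 (sqrt 3 * pi powr (3 / 2) / 332800 * exp (E n) * M ^ n
                  * (4 * real n) powr (- sqrt (real n)) * real n powr (- 5 / 2))"
proof -
  define N where "N = real (card {p :: nat. prime p \<and> 3 * n < p \<and> p < 4 * n})"
  \<comment> \<open>all factors except \<open>M\<^sup>n\<close> and the one that pays for the prime powers\<close>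
  define K where "K = sqrt 3 * pi powr (3/2) / 332800 * exp (E n) * real n powr (-5/2)"
  have n: "n \<ge> 1" and ln4n: "ln (4 * real n) > 0" using assms by auto
  have K: "K > 0" "K \<le> 1"
    using n factor_le_1[OF n] by (auto simp: K_def)
  have ln_K: "ln K \<le> 0" using K by simp
  have "ln (K * M ^ n * (4 * real n) powr (- sqrt (real n)))
      = ln K + real n * ln M - sqrt (real n) * ln (4 * real n)"
    using K n M_pos by (simp add: ln_mult ln_realpow ln_powr)
  also have "\<dots> \<le> real n / 10 - sqrt (real n) * ln (4 * real n)"
    using mult_left_mono[OF ln_M_le, of "real n"] ln_K by linarith
  also have "\<dots> \<le> N * ln (4 * real n)"
  proof (cases "n < 2500")
    case True
    have "0 \<le> N * ln (4 * real n)" using ln4n by (simp add: N_def)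
    thus ?thesis using small_case[OF assms True] by linarith
  next
    case False
    thus ?thesis
      using psi_diff_large[of n] psi_diff_le_card_primes[OF n] unfolding N_def by simp
  qed
  finally have "log (4 * real n) (K * M ^ n * (4 * real n) powr (- sqrt (real n))) \<le> N"
    using ln4n by (simp add: log_def pos_divide_le_eq)
  thus ?thesis unfolding N_def K_def by (simp add: mult_ac)
qed

end
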